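(* Let $M_1$ and $M_2$ be $q$-matroids on the $\mathbb{F}_q$-vector spaces $E_1$ and $E_2$ respectively. Then $(M_1\square M_2)^*\cong M_2^*\square M_1^*$.
   Context: For a finite-dimensional $\mathbb{F}_q$-space $E$, $\mathcal{L}(E)$ is its subspace lattice. A $q$-matroid $M=(E,r)$ is given by $r:\mathcal{L}(E)\to\mathbb{Z}$ with (R1) $0\le r(A)\le\dim(A)$; (R2) $A\le B\Rightarrow r(A)\le r(B)$; (R3) $r(A+B)+r(A\cap B)\le r(A)+r(B)$. $A$ is independent if $r(A)=\dim A$. $M_1=(E_1,r_1)\cong M_2=(E_2,r_2)$ means there is an $\mathbb{F}_q$-linear isomorphism $\tau:E_1\to E_2$ with $r_2(\tau(V))=r_1(V)$ for all $V\le E_1$. The dual $M^*$ of $M=(E,r)$ is the $q$-matroid $(E,r^* )$ with $r^*(A)=\dim(A)-r(E)+r(A^\perp)$, where $A^\perp$ is the orthogonal complement with respect to a fixed non-degenerate bilinear form on $E$ for which $A\mapsto A^\perp$ is an involution; up to isomorphism $M^*$ does not depend on the form. On $E_1\oplus E_2$ the form is taken to be the orthogonal sum of the chosen forms on $E_1$ and $E_2$. Free product: for $q$-matroids $M_i=(E_i,r_i)$, with projections $\pi_i:E_1\oplus E_2\to E_i$ and embeddings $\iota_i:E_i\to E_1\oplus E_2$, put $\lambda_1(A)=r_1(E_1)-r_1(A)$ and $\nu_2(B)=\dim(B)-r_2(B)$. $M_1\square M_2$ is the $q$-matroid on $E_1\oplus E_2$ whose independent spaces are exactly the $I\le E_1\oplus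 E_2$ with $\pi_1(I\cap\iota_1(E_1))$ independent in $M_1$ and $\lambda_1(\pi_1(I\cap\iota_1(E_1)))\ge\nu_2(\pi_2(I))$. *)

theory Defs
  imports "HOL-Analysis.Product_Vector"
begin

section \<open>q-Matroids\<close>

text \<open>
  The ground space is a whole type \<open>'b\<close> made into a vector space over the finite field \<open>'k\<close> by
  \<open>scale\<close>, so \<open>E = UNIV\<close>. A rank function is total on \<open>'b set\<close>, but only its values on subspaces
  are meaningful.
\<close>

locale q_matroid = vector_space scale
  for scale :: "'k::{finite,field} \<Rightarrow> 'b::ab_group_add \<Rightarrow> 'b" +
  fixes r :: "'b set \<Rightarrow> int"
  assumes finite_dimensional: "\<exists>B. finite_dimensional_vector_space scale B"
    and rank_nonneg: "subspace A \<Longrightarrow> 0 \<le> r A"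
    and rank_le_dim: "subspace A \<Longrightarrow> r A \<le> int (dim A)"
    and rank_mono: "subspace A \<Longrightarrow> subspace B \<Longrightarrow> A \<subseteq> B \<Longrightarrow> r A \<le> r B"
    and rank_submodular: "subspace A \<Longrightarrow> subspace B \<Longrightarrow>
      r {x + y | x y. x \<in> A \<and> y \<in> B} + r (A \<inter> B) \<le> r A + r B"

definition indep_space ::
  "('k::field \<Rightarrow> 'b::ab_group_add \<Rightarrow> 'b) \<Rightarrow> ('b set \<Rightarrow> int) \<Rightarrow> 'b set \<Rightarrow> bool" where
  "indep_space s r A \<longleftrightarrow> module.subspace s A \<and> r A = int (vector_space.dim s A)"

definition q_matroid_iso ::
  "('k::field \<Rightarrow> 'b::ab_group_add \<Rightarrow> 'b) \<Rightarrow> ('b set \<Rightarrow> int) \<Rightarrow>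
   ('k \<Rightarrow> 'c::ab_group_add \<Rightarrow> 'c) \<Rightarrow> ('c set \<Rightarrow> int) \<Rightarrow> bool" where
  "q_matroid_iso s1 r1 s2 r2 \<longleftrightarrow>
     (\<exists>\<tau>. Vector_Spaces.linear s1 s2 \<tau> \<and> bij \<tau> \<and>
          (\<forall>V. module.subspace s1 V \<longrightarrow> r2 (\<tau> ` V) = r1 V))"


section \<open>Duality\<close>

definition orth :: "('b \<Rightarrow> 'b \<Rightarrow> 'k::field) \<Rightarrow> 'b set \<Rightarrow> 'b set" where
  "orth b A = {y. \<forall>x\<in>A. b x y = 0}"

definition duality_form ::
  "('k::field \<Rightarrow> 'b::ab_group_add \<Rightarrow> 'b) \<Rightarrow> ('b \<Rightarrow> 'b \<Rightarrow> 'k) \<Rightarrow> bool" where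
  "duality_form s b \<longleftrightarrow>
     (\<forall>x. Vector_Spaces.linear s (*) (\<lambda>y. b x y)) \<and>
     (\<forall>y. Vector_Spaces.linear s (*) (\<lambda>x. b x y)) \<and>
     (\<forall>x. (\<forall>y. b x y = 0) \<longrightarrow> x = 0) \<and>
     (\<forall>y. (\<forall>x. b x y = 0) \<longrightarrow> y = 0) \<and>
     (\<forall>A. module.subspace s A \<longrightarrow> orth b (orth b A) = A)"

definition form_sum ::
  "('b \<Rightarrow> 'b \<Rightarrow> 'k::field) \<Rightarrow> ('c \<Rightarrow> 'c \<Rightarrow> 'k) \<Rightarrow> 'b \<times> 'c \<Rightarrow> 'b \<times> 'c \<Rightarrow> 'k" where
  "form_sum b1 b2 x y = b1 (fst x) (fst y) + b2 (snd x) (snd y)"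

definition dual_rank ::
  "('k::field \<Rightarrow> 'b::ab_group_add \<Rightarrow> 'b) \<Rightarrow> ('b \<Rightarrow> 'b \<Rightarrow> 'k) \<Rightarrow> ('b set \<Rightarrow> int) \<Rightarrow> 'b set \<Rightarrow> int"
  where "dual_rank s b r A = int (vector_space.dim s A) - r UNIV + r (orth b A)"


section \<open>The free product\<close>

definition corank :: "('b set \<Rightarrow> int) \<Rightarrow> 'b set \<Rightarrow> int" where
  "corank r A = r UNIV - r A"

definition nullity ::
  "('k::field \<Rightarrow> 'b::ab_group_add \<Rightarrow> 'b) \<Rightarrow> ('b set \<Rightarrow> int) \<Rightarrow> 'b set \<Rightarrow> int" where
  "nullity s r B = int (vector_space.dim s B) - r B"

definition free_product_indep ::
  "('k::field \<Rightarrow> 'b::ab_group_add \<Rightarrow> 'b) \<Rightarrow> ('b set \<Rightarrow> int) \<Rightarrow>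
   ('k \<Rightarrow> 'c::ab_group_add \<Rightarrow> 'c) \<Rightarrow> ('c set \<Rightarrow> int) \<Rightarrow> ('b \<times> 'c) set \<Rightarrow> bool" where
  "free_product_indep s1 r1 s2 r2 I \<longleftrightarrow>
     indep_space s1 r1 (fst ` (I \<inter> range (\<lambda>x. (x, 0)))) \<and>
     corank r1 (fst ` (I \<inter> range (\<lambda>x. (x, 0)))) \<ge> nullity s2 r2 (snd ` I)"

definition is_free_product ::
  "('k::{finite,field} \<Rightarrow> 'b::ab_group_add \<Rightarrow> 'b) \<Rightarrow> ('b set \<Rightarrow> int) \<Rightarrow>
   ('k \<Rightarrow> 'c::ab_group_add \<Rightarrow> 'c) \<Rightarrow> ('c set \<Rightarrow> int) \<Rightarrow> (('b \<times> 'c) set \<Rightarrow> int) \<Rightarrow> bool" where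
  "is_free_product s1 r1 s2 r2 r \<longleftrightarrow>
     q_matroid (module_prod.scale s1 s2) r \<and>
     (\<forall>I. module.subspace (module_prod.scale s1 s2) I \<longrightarrow>
        (indep_space (module_prod.scale s1 s2) r I \<longleftrightarrow> free_product_indep s1 r1 s2 r2 I))"

text \<open>
  By \<open>is_free_product_exists\<close> and \<open>is_free_product_unique\<close> below, for q-matroids such a rank
  function exists and its values on subspaces are determined; the choice only affects the
  meaningless values on other sets.
\<close>

definition free_product ::
  "('k::{finite,field} \<Rightarrow> 'b::ab_group_add \<Rightarrow> 'b) \<Rightarrow> ('b set \<Rightarrow> int) \<Rightarrow>
   ('k \<Rightarrow> 'c::ab_group_add \<Rightarrow> 'c) \<Rightarrow> ('c set \<Rightarrow> int) \<Rightarrow> ('b \<times> 'c) set \<Rightarrow> int" where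
  "free_product s1 r1 s2 r2 = (SOME r. is_free_product s1 r1 s2 r2 r)"


section \<open>Existence and uniqueness of the free product\<close>

context q_matroid
begin

lemma rank_span_Un:
  "r (span (A \<union> B)) + r (span A \<inter> span B) \<le> r (span A) + r (span B)"
  using rank_submodular[of "span A" "span B"] by (simp add: span_Un)

lemma rank_diff_le_dim_diff:
  assumes A: "subspace A" and B: "subspace B" and AB: "A \<subseteq> B"
  shows "r B - r A \<le> int (dim B) - int (dim A)"
proof -
  obtain Bs where "finite_dimensional_vector_space scale Bs"
    using finite_dimensional by blast
  then interpret fd: finite_dimensional_vector_space scale Bs .
  obtain S where S: "S \<subseteq> A" "independent S" "A \<subseteq> span S"
    by (metis basis_exists)
  obtain T where T: "S \<subseteq> T" "T \<subseteq> B" "independent T" "B \<subseteq> span T"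
    using maximal_independent_subset_extend[OF order_trans[OF S(1) AB] S(2)] by blast
  have fT: "finite T" using T fd.finiteI_independent by blast
  have spS: "span S = A" using S A by (simp add: span_subspace)
  have spT: "span T = B" using T B by (simp add: span_subspace)
  have dA: "dim A = card S" using spS S(2) by (metis dim_span dim_eq_card_independent)
  have dB: "dim B = card T" using spT T(3) by (metis dim_span dim_eq_card_independent)
  have "r (span (S \<union> (T - S))) + r (span S \<inter> span (T - S)) \<le> r (span S) + r (span (T - S))"
    by (rule rank_span_Un)
  moreover have "S \<union> (T - S) = T" using T by auto
  moreover have "0 \<le> r (span S \<inter> span (T - S))"
    by (intro rank_nonneg subspace_inter subspace_span)
  moreover have "r (span (T - S)) \<le> int (card (T - S))"
    using rank_le_dim[of "span (T - S)"] fT dim_le_card'[of "T - S"] by simp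
  moreover have "card (T - S) = card T - card S" "card S \<le> card T"
    using T fT by (auto simp: card_Diff_subset finite_subset card_mono)
  ultimately show ?thesis using spS spT dA dB by simp
qed

lemma indep_space_attains_rank:
  assumes A: "subspace A"
  shows "\<exists>I\<subseteq>A. indep_space scale r I \<and> int (dim I) = r A"
proof -
  obtain Bs where "finite_dimensional_vector_space scale Bs"
    using finite_dimensional by blast
  then interpret fd: finite_dimensional_vector_space scale Bs .
  let ?P = "\<lambda>I. I \<subseteq> A \<and> indep_space scale r I"
  have "?P {0}"
    using A rank_nonneg[OF subspace_single_0] rank_le_dim[OF subspace_single_0]
    by (auto simp: indep_space_def subspace_0)
  moreover have "\<forall>I. ?P I \<longrightarrow> dim I < Suc fd.dimension"
    using fd.dim_subset_UNIV by (simp add: less_Suc_eq_le)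
  ultimately obtain I where I: "?P I" and max: "\<forall>J. ?P J \<longrightarrow> dim J \<le> dim I"
    using ex_has_greatest_nat[of ?P "{0}" dim "Suc fd.dimension"] by blast
  have sI: "subspace I" and rI: "r I = int (dim I)" and IA: "I \<subseteq> A"
    using I by (auto simp: indep_space_def)
  have spI: "span I = I" using sI by simp
  have step: "r (span (insert x I)) = r I" if x: "x \<in> A" for x
  proof (rule ccontr)
    assume neq: "r (span (insert x I)) \<noteq> r I"
    have le: "r I \<le> r (span (insert x I))"
      using sI by (intro rank_mono) (auto intro: span_base)
    have "x \<notin> I"
      using neq spI by (metis insert_absorb)
    then have d: "dim (span (insert x I)) = Suc (dim I)"
      by (metis Suc_eq_plus1 dim_span fd.dim_insert spI)
    have "r (span (insert x I)) \<le> int (Suc (dim I))"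
      using rank_le_dim[of "span (insert x I)"] d by simp
    then have "indep_space scale r (span (insert x I))"
      using neq le rI d by (simp add: indep_space_def)
    moreover have "span (insert x I) \<subseteq> A"
      using x IA A by (intro span_minimal) auto
    ultimately have "dim (span (insert x I)) \<le> dim I" using max by blast
    then show False using d by simp
  qed
  have fin: "r (span (F \<union> I)) = r I" if "finite F" "F \<subseteq> A" for F
    using that
  proof (induction F rule: finite_induct)
    case empty
    show ?case by (metis Un_empty_left spI)
  next
    case (insert x F)
    have "r (span ((F \<union> I) \<union> (insert x I))) + r (span (F \<union> I) \<inter> span (insert x I))
          \<le> r (span (F \<union> I)) + r (span (insert x I))"
      by (rule rank_span_Un)
    moreover have "(F \<union> I) \<union> (insert x I) = insert x F \<union> I" by auto
    moreover have "r I \<le> r (span (F \<union> I) \<inter> span (insert x I))"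
      using sI by (intro rank_mono subspace_inter subspace_span) (auto intro: span_base)
    moreover have "r I \<le> r (span (insert x F \<union> I))"
      using sI by (intro rank_mono subspace_span) (auto intro: span_base)
    ultimately show ?case using insert step[of x] by simp
  qed
  obtain S where S: "S \<subseteq> A" "independent S" "A \<subseteq> span S"
    by (metis basis_exists)
  have "finite S" using S fd.finiteI_independent by blast
  moreover have "span (S \<union> I) = A"
  proof
    show "span (S \<union> I) \<subseteq> A" using S IA A by (intro span_minimal) auto
    show "A \<subseteq> span (S \<union> I)" using S span_mono[of S "S \<union> I"] by auto
  qed
  ultimately have "r A = r I" using fin[of S] S by simp
  then show ?thesis using I rI by auto
qed

lemma indep_space_dim_le_rank:
  assumes "subspace A" "I \<subseteq> A" "indep_space scale r I"
  shows "int (dim I) \<le> r A"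
  using assms rank_mono[of I A] by (auto simp: indep_space_def)

end

lemma q_matroid_rank_unique:
  assumes r: "q_matroid s r" and r': "q_matroid s r'"
    and eq: "\<And>I. module.subspace s I \<Longrightarrow> indep_space s r I \<longleftrightarrow> indep_space s r' I"
    and A: "module.subspace s A"
  shows "r A = r' A"
proof -
  have le: "t A \<le> t' A" if t: "q_matroid s t" and t': "q_matroid s t'"
    and tt': "\<And>I. module.subspace s I \<Longrightarrow> indep_space s t I \<longleftrightarrow> indep_space s t' I" for t t'
  proof -
    obtain I where I: "I \<subseteq> A" "indep_space s t I" "int (vector_space.dim s I) = t A"
      using q_matroid.indep_space_attains_rank[OF t A] by blast
    moreover have "module.subspace s I" using I(2) by (simp add: indep_space_def)
    ultimately have "indep_space s t' I" using tt' by blast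
    then show ?thesis using q_matroid.indep_space_dim_le_rank[OF t' A I(1)] I(3) by simp
  qed
  show ?thesis using le[OF r r'] le[OF r' r] eq by (intro antisym) blast+
qed

lemma is_free_product_unique:
  assumes "is_free_product s1 r1 s2 r2 r" "is_free_product s1 r1 s2 r2 r'"
    and "module.subspace (module_prod.scale s1 s2) A"
  shows "r A = r' A"
  using assms q_matroid_rank_unique[of "module_prod.scale s1 s2" r r' A]
  unfolding is_free_product_def by blast

lemma is_free_product_exists:
  fixes s1 :: "'k::{finite,field} \<Rightarrow> 'b::ab_group_add \<Rightarrow> 'b"
    and s2 :: "'k \<Rightarrow> 'c::ab_group_add \<Rightarrow> 'c"
  assumes "q_matroid s1 r1" "q_matroid s2 r2"
  shows "\<exists>r. is_free_product s1 r1 s2 r2 r"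
proof -
  interpret M1: q_matroid s1 r1 by fact
  interpret M2: q_matroid s2 r2 by fact
  obtain B1 B2 where B: "finite_dimensional_vector_space s1 B1" "finite_dimensional_vector_space s2 B2"
    using M1.finite_dimensional M2.finite_dimensional by (elim exE)
  from B interpret fd1: finite_dimensional_vector_space s1 B1
    + fd2: finite_dimensional_vector_space s2 B2 .
  interpret P: finite_dimensional_vector_space_prod s1 s2 B1 B2 ..
  interpret lf: Vector_Spaces.linear P.scale s1 fst by (rule P.linear_fst)
  interpret ls: Vector_Spaces.linear P.scale s2 snd by (rule P.linear_snd)
  let ?i = "\<lambda>A. A \<inter> range (\<lambda>x. (x, 0))"
  define p where "p A = fst ` ?i A" for A :: "('b \<times> 'c) set"
  define q where "q A = snd ` A" for A :: "('b \<times> 'c) set"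
  let ?add = "\<lambda>A B. {x + y | x y. x \<in> A \<and> y \<in> B}"
  have pmem: "x \<in> p A \<longleftrightarrow> (x, 0) \<in> A" for x A by (force simp: p_def)
  have sp: "M1.subspace (p A)" if "P.p.subspace A" for A
    unfolding M1.subspace_def pmem
  proof (intro conjI ballI allI)
    show "(0, 0) \<in> A" using P.p.subspace_0[OF that] by (simp add: zero_prod_def)
    show "(x + y, 0) \<in> A" if "x \<in> p A" "y \<in> p A" for x y
      using P.p.subspace_add[OF \<open>P.p.subspace A\<close>, of "(x, 0)" "(y, 0)"] that by (simp add: pmem)
    show "(s1 c x, 0) \<in> A" if "x \<in> p A" for c x
      using P.p.subspace_scale[OF \<open>P.p.subspace A\<close>, of "(x, 0)" c] that
      by (simp add: pmem P.scale_prod)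
  qed
  have sq: "M2.subspace (q A)" if "P.p.subspace A" for A
    using that unfolding q_def by (rule ls.subspace_image)
  have dim: "P.p.dim A = M1.dim (p A) + M2.dim (q A)" if A: "P.p.subspace A" for A
  proof -
    let ?E = "UNIV \<times> {0} :: ('b \<times> 'c) set"
    have sE: "P.p.subspace ?E"
      by (intro P.subspace_Times M1.subspace_UNIV M2.subspace_single_0)
    have "?add A ?E = UNIV \<times> q A"
    proof (intro set_eqI iffI)
      fix z :: "'b \<times> 'c" assume "z \<in> UNIV \<times> q A"
      then obtain x where "(x, snd z) \<in> A" by (auto simp: q_def mem_Times_iff)
      moreover have "z = (x, snd z) + (fst z - x, 0)" by (simp add: prod_eq_iff)
      ultimately show "z \<in> ?add A ?E" by blast
    qed (force simp: q_def mem_Times_iff)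
    moreover have "P.p.dim (?add A ?E) + P.p.dim (A \<inter> ?E) = P.p.dim A + P.p.dim ?E"
      using P.p.dim_sums_Int[OF A sE] .
    moreover have "A \<inter> ?E = p A \<times> {0}" by (auto simp: pmem)
    ultimately show ?thesis
      using sp[OF A] sq[OF A] by (simp add: P.dim_Times)
  qed
  have pmono: "p A \<subseteq> p B" and qmono: "q A \<subseteq> q B" if "A \<subseteq> B" for A B
    using that by (auto simp: p_def q_def)
  have psum: "?add (p A) (p B) \<subseteq> p (?add A B)" for A B
  proof
    fix z assume "z \<in> ?add (p A) (p B)"
    then obtain x y where "z = x + y" "(x, 0) \<in> A" "(y, 0) \<in> B" by (auto simp: pmem)
    moreover from this have "(z, 0 :: 'c) = (x, 0) + (y, 0)" by simp
    ultimately show "z \<in> p (?add A B)" unfolding pmem by blast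
  qed
  have pint: "p (A \<inter> B) = p A \<inter> p B" for A B by (auto simp: pmem)
  have qsum: "q (?add A B) = ?add (q A) (q B)" for A B
    unfolding q_def by force
  have qint: "q (A \<inter> B) \<subseteq> q A \<inter> q B" for A B by (auto simp: q_def)
  define f where "f A = r1 (p A) + int (M2.dim (q A))" for A
  define g where "g A = r1 UNIV + r2 (q A)" for A
  define r where "r A = min (f A) (g A)" for A
  have ff: "f (?add A B) + f (A \<inter> B) \<le> f A + f B"
    if A: "P.p.subspace A" and B: "P.p.subspace B" for A B
  proof -
    have sAB: "P.p.subspace (?add A B)" "P.p.subspace (A \<inter> B)"
      by (rule P.p.subspace_sums[OF A B], rule P.p.subspace_inter[OF A B])
    have spAB: "M1.subspace (?add (p A) (p B))"
      by (rule M1.subspace_sums[OF sp[OF A] sp[OF B]])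
    have "P.p.dim (?add A B) + P.p.dim (A \<inter> B) = P.p.dim A + P.p.dim B"
      by (rule P.p.dim_sums_Int[OF A B])
    then have 1: "M1.dim (p (?add A B)) + M2.dim (q (?add A B)) + (M1.dim (p (A \<inter> B)) + M2.dim (q (A \<inter> B)))
       = M1.dim (p A) + M2.dim (q A) + (M1.dim (p B) + M2.dim (q B))"
      unfolding dim[OF sAB(1)] dim[OF sAB(2)] dim[OF A] dim[OF B] .
    have 2: "M1.dim (?add (p A) (p B)) + M1.dim (p A \<inter> p B) = M1.dim (p A) + M1.dim (p B)"
      by (rule fd1.dim_sums_Int[OF sp[OF A] sp[OF B]])
    have 3: "r1 (p (?add A B)) - r1 (?add (p A) (p B))
       \<le> int (M1.dim (p (?add A B))) - int (M1.dim (?add (p A) (p B)))"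
      by (rule M1.rank_diff_le_dim_diff[OF spAB sp[OF sAB(1)] psum])
    have 4: "r1 (?add (p A) (p B)) + r1 (p A \<inter> p B) \<le> r1 (p A) + r1 (p B)"
      by (rule M1.rank_submodular[OF sp[OF A] sp[OF B]])
    show ?thesis using 1 2 3 4 unfolding f_def pint by linarith
  qed
  have gg: "g (?add A B) + g (A \<inter> B) \<le> g A + g B"
    if A: "P.p.subspace A" and B: "P.p.subspace B" for A B
  proof -
    have "r2 (q (A \<inter> B)) \<le> r2 (q A \<inter> q B)"
      by (rule M2.rank_mono[OF sq[OF P.p.subspace_inter[OF A B]]
            M2.subspace_inter[OF sq[OF A] sq[OF B]] qint])
    moreover have "r2 (?add (q A) (q B)) + r2 (q A \<inter> q B) \<le> r2 (q A) + r2 (q B)"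
      by (rule M2.rank_submodular[OF sq[OF A] sq[OF B]])
    ultimately show ?thesis unfolding g_def qsum by linarith
  qed
  have fg: "g (?add A B) + f (A \<inter> B) \<le> f A + g B"
    if A: "P.p.subspace A" and B: "P.p.subspace B" for A B
  proof -
    have sAB: "P.p.subspace (A \<inter> B)" using A B by (rule P.p.subspace_inter)
    have sum: "M2.subspace (?add (q A) (q B))" 
      by (rule M2.subspace_sums[OF sq[OF A] sq[OF B]])
    have "q B \<subseteq> ?add (q A) (q B)"
      using M2.subspace_0[OF sq[OF A]] by force
    then have 1: "r2 (?add (q A) (q B)) - r2 (q B)
       \<le> int (M2.dim (?add (q A) (q B))) - int (M2.dim (q B))"
      by (intro M2.rank_diff_le_dim_diff sum sq B)
    have 2: "M2.dim (?add (q A) (q B)) + M2.dim (q A \<inter> q B) = M2.dim (q A) + M2.dim (q B)"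
      by (rule fd2.dim_sums_Int[OF sq[OF A] sq[OF B]])
    have 3: "M2.dim (q (A \<inter> B)) \<le> M2.dim (q A \<inter> q B)"
      using qint by (rule fd2.dim_subset)
    have 4: "r1 (p (A \<inter> B)) \<le> r1 (p A)"
      using A sAB sp pmono by (intro M1.rank_mono) auto
    show ?thesis using 1 2 3 4 unfolding f_def g_def qsum by linarith
  qed
  have M: "q_matroid P.scale r"
  proof unfold_locales
    show "\<exists>B. finite_dimensional_vector_space P.scale B"
      using P.p.finite_dimensional_vector_space_axioms by blast
  next
    fix A assume A: "P.p.subspace A"
    show "0 \<le> r A"
      using A sp sq M1.rank_nonneg[of "p A"] M1.rank_nonneg[of UNIV] M2.rank_nonneg[of "q A"]
      by (simp add: r_def f_def g_def)
    show "r A \<le> int (P.p.dim A)"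
      using A sp M1.rank_le_dim[of "p A"] dim[OF A] by (simp add: r_def f_def)
  next
    fix A B assume A: "P.p.subspace A" and B: "P.p.subspace B" and AB: "A \<subseteq> B"
    have "r1 (p A) \<le> r1 (p B)" "r2 (q A) \<le> r2 (q B)" "M2.dim (q A) \<le> M2.dim (q B)"
      using sp sq A B pmono[OF AB] qmono[OF AB]
      by (auto intro: M1.rank_mono M2.rank_mono fd2.dim_subset)
    then show "r A \<le> r B" unfolding r_def f_def g_def by linarith
  next
    fix A B assume A: "P.p.subspace A" and B: "P.p.subspace B"
    have "?add B A = ?add A B" by (rule Collect_cong) (metis add.commute)
    then have "g (?add A B) + f (A \<inter> B) \<le> f B + g A"
      using fg[OF B A] by (simp add: Int_commute)
    then show "r (?add A B) + r (A \<inter> B) \<le> r A + r B"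
      using ff[OF A B] gg[OF A B] fg[OF A B] unfolding r_def by linarith
  qed
  moreover have "indep_space P.scale r I \<longleftrightarrow> free_product_indep s1 r1 s2 r2 I"
    if I: "P.p.subspace I" for I
  proof -
    have "r1 (p I) \<le> int (M1.dim (p I))" using M1.rank_le_dim sp I by blast
    then show ?thesis
      using dim[OF I] sp[OF I] I
      unfolding indep_space_def free_product_indep_def corank_def nullity_def
        p_def[symmetric] q_def[symmetric] r_def f_def g_def by auto
  qed
  ultimately show ?thesis unfolding is_free_product_def by blast
qed

end

theory Submission
  imports Defs
begin

text \<open>
  On subspaces the rank function of the free product is
  \<open>r A = min (r1 (A \<inter> E1) + dim (\<pi>2 A)) (r1 E1 + r2 (\<pi>2 A))\<close>.
  Orthogonal complement exchanges slices and projections,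
  \<open>A\<^sup>\<bottom> \<inter> E1 = (\<pi>1 A)\<^sup>\<bottom>\<close> and \<open>\<pi>2 (A\<^sup>\<bottom>) = (A \<inter> E2)\<^sup>\<bottom>\<close>. Substituting this into the dual
  rank of the free product gives a minimum of two terms which are, in the other order, those of the
  formula for the free product of the duals. The isomorphism is the swap of coordinates.

  The orthogonal sum of two duality forms need not be a duality form: if one summand is symmetric
  and the other alternating, the sum is not reflexive. So only dimension formulas, which need no
  more than nondegeneracy, are used for it.
\<close>

section \<open>Orthogonal complements for a nondegenerate bilinear form\<close>

text \<open>Linearity on the right makes complements subspaces, linearity on the left allows them to
  be tested on spanning sets, and \<open>nondegenerate\<close> says that the right radical is
  zero.\<close>

locale nondegenerate_form = finite_dimensional_vector_space scale Basis
  for scale :: "'k::field \<Rightarrow> 'b::ab_group_add \<Rightarrow> 'b" and Basis +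
  fixes b :: "'b \<Rightarrow> 'b \<Rightarrow> 'k"
  assumes linear_right: "Vector_Spaces.linear scale (*) (\<lambda>y. b x y)"
    and linear_left: "Vector_Spaces.linear scale (*) (\<lambda>x. b x y)"
    and nondegenerate: "(\<And>x. b x y = 0) \<Longrightarrow> y = 0"
begin

lemma subspace_orth: "subspace (orth b A)"
proof -
  have "orth b A = (\<Inter>x\<in>A. {y. b x y = 0})"
    by (auto simp: orth_def)
  then show ?thesis
    using module_hom.subspace_kernel[OF linear_right[unfolded linear_iff_module_hom]]
    by (simp add: subspace_Int)
qed

lemma orth_span: "orth b (span S) = orth b S"
proof
  show "orth b (span S) \<subseteq> orth b S"
    by (auto simp: orth_def span_base)
  show "orth b S \<subseteq> orth b (span S)"
  proof
    fix y assume y: "y \<in> orth b S"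
    have "subspace {x. b x y = 0}"
      using module_hom.subspace_kernel[OF linear_left[unfolded linear_iff_module_hom]] .
    moreover have "S \<subseteq> {x. b x y = 0}" using y by (auto simp: orth_def)
    ultimately have "span S \<subseteq> {x. b x y = 0}" by (rule span_minimal[rotated])
    then show "y \<in> orth b (span S)" by (auto simp: orth_def)
  qed
qed

lemma orth_antimono: "A \<subseteq> B \<Longrightarrow> orth b B \<subseteq> orth b A"
  by (auto simp: orth_def)

lemma orth_UNIV: "orth b UNIV = {0}"
proof
  show "orth b UNIV \<subseteq> {0}" by (auto simp: orth_def intro: nondegenerate)
  show "{0} \<subseteq> orth b UNIV" using subspace_0[OF subspace_orth] by blast
qed

lemma orth_sum:
  assumes A: "subspace A" and B: "subspace B"
  shows "orth b {x + y | x y. x \<in> A \<and> y \<in> B} = orth b A \<inter> orth b B"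
proof -
  have "orth b {x + y | x y. x \<in> A \<and> y \<in> B} = orth b (span (A \<union> B))"
    using A B by (simp add: span_Un span_eq_iff[THEN iffD2])
  then show ?thesis
    unfolding orth_span by (auto simp: orth_def)
qed

text \<open>If some \<open>w\<close> in \<open>W\<close> has \<open>f w \<noteq> 0\<close>,
  subtracting a multiple of \<open>w\<close> moves any vector of \<open>W\<close> into the kernel,
  so \<open>w\<close> and the kernel part together span \<open>W\<close>.\<close>

lemma dim_Int_kernel:
  assumes W: "subspace W" and f: "Vector_Spaces.linear scale (*) f"
  shows "dim W \<le> Suc (dim (W \<inter> {y. f y = 0}))"
proof (cases "\<exists>w\<in>W. f w \<noteq> 0")
  case True
  interpret f: Vector_Spaces.linear scale "(*)" f by (rule f)
  obtain w where w: "w \<in> W" "f w \<noteq> 0" using True by blast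
  have "W \<subseteq> span (insert w (W \<inter> {y. f y = 0}))"
  proof
    fix v assume v: "v \<in> W"
    have "v - scale (f v / f w) w \<in> W \<inter> {y. f y = 0}"
      using v w W by (simp add: subspace_diff subspace_scale f.diff f.scale)
    then show "v \<in> span (insert w (W \<inter> {y. f y = 0}))"
      unfolding span_breakdown_eq by (blast intro: span_base)
  qed
  then have "dim W \<le> dim (insert w (W \<inter> {y. f y = 0}))" by (rule dim_mono)
  then show ?thesis by (simp add: dim_insert split: if_splits)
next
  case False
  then have "W \<inter> {y. f y = 0} = W" by auto
  then show ?thesis by simp
qed

text \<open>The complement of \<open>A\<close> is cut out by one linear equation per basis vector of
  \<open>A\<close>, and each equation costs at most one dimension.\<close>

lemma dim_orth_ge:
  assumes A: "subspace A"
  shows "dim (UNIV :: 'b set) \<le> dim (orth b A) + dim A"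
proof -
  have ge: "dim (UNIV :: 'b set) \<le> dim (orth b S) + card S" if "finite S" for S
    using that
  proof (induction S rule: finite_induct)
    case empty
    show ?case by (simp add: orth_def)
  next
    case (insert x S)
    have "orth b (insert x S) = orth b S \<inter> {y. b x y = 0}"
      by (auto simp: orth_def)
    then show ?case
      using insert dim_Int_kernel[OF subspace_orth linear_right, of S x] by simp
  qed
  obtain S where "finite S" "span S = A" "card S = dim A"
    using basis_subspace_exists[OF A] by metis
  then show ?thesis using ge orth_span by metis
qed

text \<open>The lower bound is applied to \<open>A\<close> and to a vector space complement
  \<open>C\<close>. Since \<open>A + C\<close> is everything, \<open>orth b A\<close> and
  \<open>orth b C\<close> meet in zero, so their dimensions add up to at most that of the whole
  space; this forces equality.\<close>

lemma dim_orth: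
  assumes A: "subspace A"
  shows "dim (orth b A) + dim A = dim (UNIV :: 'b set)"
proof -
  obtain S where S: "S \<subseteq> A" "independent S" "A \<subseteq> span S" "card S = dim A"
    using basis_exists by metis
  obtain T where T: "S \<subseteq> T" "independent T" "(UNIV :: 'b set) \<subseteq> span T"
    using maximal_independent_subset_extend[of S UNIV] S(2) by auto
  define C where "C = span (T - S)"
  have C: "subspace C" by (simp add: C_def)
  have fT: "finite T" using T(2) by (rule finiteI_independent)
  have "dim C \<le> card (T - S)"
    unfolding C_def using dim_le_card'[of "T - S"] fT by simp
  moreover have "card T = dim (UNIV :: 'b set)"
    using T by (intro basis_card_eq_dim) auto
  moreover have "card (T - S) + card S = card T"
    using T(1) fT by (simp add: card_Diff_subset finite_subset card_mono)
  ultimately have dimC: "dim C + dim A \<le> dim (UNIV :: 'b set)"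
    using S(4) by simp
  have "span S = A" using S A by (intro span_subspace)
  then have sum: "{x + y | x y. x \<in> A \<and> y \<in> C} = UNIV"
    using span_Un[of S "T - S"] T unfolding C_def by (simp add: Un_absorb1 top.extremum_unique)
  then have "orth b A \<inter> orth b C = {0}"
    using orth_sum[OF A C] orth_UNIV by simp
  then have "dim (orth b A) + dim (orth b C)
      = dim {x + y | x y. x \<in> orth b A \<and> y \<in> orth b C}"
    using dim_sums_Int[OF subspace_orth subspace_orth, of A C] by simp
  also have "\<dots> \<le> dim (UNIV :: 'b set)" by (intro dim_subset) simp
  finally show ?thesis
    using dim_orth_ge[OF A] dim_orth_ge[OF C] dimC by linarith
qed

text \<open>One inclusion is antitonicity; equality follows by counting dimensions with
  \<open>dim_orth\<close>, which avoids double complements.\<close>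

lemma orth_Int:
  assumes A: "subspace A" and B: "subspace B"
  shows "orth b (A \<inter> B) = {x + y | x y. x \<in> orth b A \<and> y \<in> orth b B}" (is "_ = ?S")
proof (rule sym, rule subspace_dim_equal)
  show "subspace ?S" by (intro subspace_sums subspace_orth)
  show "subspace (orth b (A \<inter> B))" by (rule subspace_orth)
  have "orth b A \<subseteq> orth b (A \<inter> B)" "orth b B \<subseteq> orth b (A \<inter> B)"
    by (auto intro!: orth_antimono)
  then show "?S \<subseteq> orth b (A \<inter> B)"
    using subspace_add[OF subspace_orth[of "A \<inter> B"]] by blast
  have "dim ?S + dim (orth b {x + y | x y. x \<in> A \<and> y \<in> B}) = dim (orth b A) + dim (orth b B)"
    unfolding orth_sum[OF A B] by (intro dim_sums_Int subspace_orth)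
  moreover have "dim {x + y | x y. x \<in> A \<and> y \<in> B} + dim (A \<inter> B) = dim A + dim B"
    using A B by (rule dim_sums_Int)
  ultimately show "dim (orth b (A \<inter> B)) \<le> dim ?S"
    using dim_orth[OF A] dim_orth[OF B] dim_orth[OF subspace_inter[OF A B]]
      dim_orth[OF subspace_sums[OF A B]] by linarith
qed

end

section \<open>Duals of q-matroids\<close>

lemma duality_form_nondegenerate:
  assumes "finite_dimensional_vector_space s Basis" "duality_form s b"
  shows "nondegenerate_form s Basis b"
  using assms
  by (intro nondegenerate_form.intro nondegenerate_form_axioms.intro) (simp_all add: duality_form_def)

text \<open>Nonnegativity and monotonicity express that \<open>r\<close> grows no faster than
  dimension, applied to complements. Submodularity is that of \<open>r\<close> on the complements,
  since \<open>orth\<close> exchanges sums and intersections.\<close>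

lemma q_matroid_dual_rank:
  assumes M: "q_matroid s r" and F: "nondegenerate_form s Basis b"
  shows "q_matroid s (dual_rank s b r)"
proof -
  interpret M: q_matroid s r by (rule M)
  interpret F: nondegenerate_form s Basis b by (rule F)
  let ?add = "\<lambda>A B. {x + y | x y. x \<in> A \<and> y \<in> B}"
  show ?thesis
  proof unfold_locales
    show "\<exists>B. finite_dimensional_vector_space s B" by (rule M.finite_dimensional)
  next
    fix A assume A: "M.subspace A"
    note d = F.dim_orth[OF A]
    have "r UNIV - r (orth b A) \<le> int (M.dim (UNIV :: 'b set)) - int (M.dim (orth b A))"
      by (intro M.rank_diff_le_dim_diff F.subspace_orth M.subspace_UNIV) simp
    then show "0 \<le> dual_rank s b r A" using d unfolding dual_rank_def by linarith
    have "r (orth b A) \<le> r UNIV"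
      by (intro M.rank_mono F.subspace_orth M.subspace_UNIV) simp
    then show "dual_rank s b r A \<le> int (M.dim A)" unfolding dual_rank_def by linarith
  next
    fix A B assume A: "M.subspace A" and B: "M.subspace B" and AB: "A \<subseteq> B"
    have "r (orth b A) - r (orth b B) \<le> int (M.dim (orth b A)) - int (M.dim (orth b B))"
      using AB by (intro M.rank_diff_le_dim_diff F.subspace_orth F.orth_antimono)
    then show "dual_rank s b r A \<le> dual_rank s b r B"
      using F.dim_orth[OF A] F.dim_orth[OF B] unfolding dual_rank_def by linarith
  next
    fix A B assume A: "M.subspace A" and B: "M.subspace B"
    have "r (?add (orth b A) (orth b B)) + r (orth b A \<inter> orth b B) \<le> r (orth b A) + r (orth b B)"
      by (intro M.rank_submodular F.subspace_orth)
    then show "dual_rank s b r (?add A B) + dual_rank s b r (A \<inter> B)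
        \<le> dual_rank s b r A + dual_rank s b r B"
      using F.dim_sums_Int[OF A B]
      unfolding dual_rank_def F.orth_sum[OF A B] F.orth_Int[OF A B] by linarith
  qed
qed

section \<open>Dimensions, slices and projections of subspaces\<close>

text \<open>A basis of \<open>A\<close> is extended to one of \<open>B\<close>, and
  \<open>n - dim A\<close> of the new vectors are kept. This later provides a space of prescribed
  nullity.\<close>

lemma (in finite_dimensional_vector_space) intermediate_subspace:
  assumes A: "subspace A" and B: "subspace B" and AB: "A \<subseteq> B"
    and n: "dim A \<le> n" "n \<le> dim B"
  obtains C where "subspace C" "A \<subseteq> C" "C \<subseteq> B" "dim C = n"
proof -
  obtain S where S: "S \<subseteq> A" "independent S" "A \<subseteq> span S" "card S = dim A"
    using basis_exists by metis
  obtain T where T: "S \<subseteq> T" "T \<subseteq> B" "independent T" "B \<subseteq> span T"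
    using maximal_independent_subset_extend[of S B] S(1,2) AB by auto
  have fT: "finite T" using T(3) by (rule finiteI_independent)
  have "card T = dim B" using T by (intro basis_card_eq_dim)
  then have "n - dim A \<le> card (T - S)"
    using n S(4) T(1) fT by (simp add: card_Diff_subset finite_subset)
  then obtain U where U: "U \<subseteq> T - S" "card U = n - dim A" "finite U"
    by (rule obtain_subset_with_card_n)
  have "card (S \<union> U) = n"
    using U S(4) n finite_subset[OF T(1) fT] by (subst card_Un_disjoint) auto
  moreover have "independent (S \<union> U)"
    using T(1) U(1) by (intro independent_mono[OF T(3)]) blast
  ultimately have "dim (span (S \<union> U)) = n"
    by (simp add: dim_eq_card_independent)
  moreover have "A \<subseteq> span (S \<union> U)" using S(3) span_mono[of S "S \<union> U"] by auto
  moreover have "span (S \<union> U) \<subseteq> B"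
    using T(1,2) U(1) B by (intro span_minimal) auto
  ultimately show ?thesis using that by blast
qed

text \<open>This is \<open>\<pi>1 (A \<inter> E1)\<close> from the free product, written as a
  preimage so that membership is immediate.\<close>

definition slice1 :: "('b::ab_group_add \<times> 'c::ab_group_add) set \<Rightarrow> 'b set" where
  "slice1 A = {x. (x, 0) \<in> A}"

definition slice2 :: "('b::ab_group_add \<times> 'c::ab_group_add) set \<Rightarrow> 'c set" where
  "slice2 A = {y. (0, y) \<in> A}"

lemma fst_image_Int_range: "fst ` (A \<inter> range (\<lambda>x. (x, 0))) = slice1 A"
  by (force simp: slice1_def)

lemma slice1_swap: "slice1 (prod.swap ` A) = slice2 A"
  by (force simp: slice1_def slice2_def)

lemma snd_swap: "snd ` (prod.swap ` A) = fst ` A"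
  by force

context vector_space_prod
begin

lemma linear_embed1: "Vector_Spaces.linear s1 scale (\<lambda>x. (x, 0))"
  by unfold_locales (auto simp: scale_def)

lemma linear_embed2: "Vector_Spaces.linear s2 scale (\<lambda>y. (0, y))"
  by unfold_locales (auto simp: scale_def)

lemma subspace_slice1: "p.subspace A \<Longrightarrow> vs1.subspace (slice1 A)"
  unfolding slice1_def
  using module_hom.subspace_linear_preimage[OF linear_embed1[unfolded linear_iff_module_hom]] .

lemma subspace_slice2: "p.subspace A \<Longrightarrow> vs2.subspace (slice2 A)"
  unfolding slice2_def
  using module_hom.subspace_linear_preimage[OF linear_embed2[unfolded linear_iff_module_hom]] .

lemma subspace_fst_image: "p.subspace A \<Longrightarrow> vs1.subspace (fst ` A)"
  using module_hom.subspace_image[OF linear_fst[unfolded linear_iff_module_hom]] .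

lemma subspace_snd_image: "p.subspace A \<Longrightarrow> vs2.subspace (snd ` A)"
  using module_hom.subspace_image[OF linear_snd[unfolded linear_iff_module_hom]] .

lemma linear_swap: "Vector_Spaces.linear scale (module_prod.scale s2 s1) prod.swap"
proof -
  interpret Q: vector_space_prod s2 s1 ..
  show ?thesis by unfold_locales (auto simp: scale_def Q.scale_def)
qed

lemma subspace_swap_image:
  "p.subspace A \<Longrightarrow> module.subspace (module_prod.scale s2 s1) (prod.swap ` A)"
  using module_hom.subspace_image[OF linear_swap[unfolded linear_iff_module_hom]] .

end

context finite_dimensional_vector_space_prod
begin

text \<open>Rank-nullity for \<open>snd\<close> on \<open>A\<close>, read off from the dimension
  formula for \<open>A + E1\<close>, which equals \<open>E1 \<times> \<pi>2 A\<close>.\<close>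

lemma dim_slice1_snd:
  assumes A: "p.subspace A"
  shows "p.dim A = vs1.dim (slice1 A) + vs2.dim (snd ` A)"
proof -
  let ?E = "UNIV \<times> {0} :: ('b \<times> 'c) set"
  let ?S = "{x + y | x y. x \<in> A \<and> y \<in> ?E}"
  have E: "p.subspace ?E"
    by (intro subspace_Times vs1.subspace_UNIV vs2.subspace_single_0)
  have "?S = UNIV \<times> snd ` A"
  proof (intro set_eqI iffI)
    fix z :: "'b \<times> 'c" assume "z \<in> UNIV \<times> snd ` A"
    then obtain x where "(x, snd z) \<in> A" by (auto simp: mem_Times_iff)
    moreover have "z = (x, snd z) + (fst z - x, 0)" by (simp add: prod_eq_iff)
    ultimately show "z \<in> ?S" by blast
  qed (force simp: mem_Times_iff)
  moreover have "A \<inter> ?E = slice1 A \<times> {0}" by (auto simp: slice1_def)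
  ultimately show ?thesis
    using p.dim_sums_Int[OF A E] subspace_slice1[OF A] subspace_snd_image[OF A]
    by (simp add: dim_Times)
qed

lemma dim_slice2_fst:
  assumes A: "p.subspace A"
  shows "p.dim A = vs2.dim (slice2 A) + vs1.dim (fst ` A)"
proof -
  interpret Q: finite_dimensional_vector_space_prod s2 s1 B2 B1 ..
  interpret PQ: finite_dimensional_vector_space_pair scale Basis_pair Q.scale Q.Basis_pair ..
  have "Q.p.dim (prod.swap ` A) = p.dim A"
    by (intro PQ.dim_image_eq linear_swap) (simp add: inj_on_subset[OF inj_swap])
  then show ?thesis
    using Q.dim_slice1_snd[OF subspace_swap_image[OF A]] by (simp add: slice1_swap snd_swap)
qed

end

section \<open>The rank function of the free product\<close>

lemma free_product_is_free_product:
  assumes "q_matroid s1 r1" "q_matroid s2 r2"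
  shows "is_free_product s1 r1 s2 r2 (free_product s1 r1 s2 r2)"
  unfolding free_product_def using is_free_product_exists[OF assms] by (rule someI_ex)

text \<open>Only the independent spaces of the free product are prescribed, so the rank is found as
  the largest dimension of an independent \<open>I\<close> inside \<open>A\<close>. Splitting
  \<open>dim I\<close> by \<open>dim_slice1_snd\<close>, independence of the slice gives the first
  bound and the corank condition the second.\<close>

lemma free_product_rank:
  assumes M1: "q_matroid s1 r1" and M2: "q_matroid s2 r2"
    and A: "module.subspace (module_prod.scale s1 s2) A"
  shows "free_product s1 r1 s2 r2 A
    = min (r1 (slice1 A) + int (vector_space.dim s2 (snd ` A))) (r1 UNIV + r2 (snd ` A))"
proof -
  interpret M1: q_matroid s1 r1 by fact
  interpret M2: q_matroid s2 r2 by fact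
  obtain B1 B2 where B: "finite_dimensional_vector_space s1 B1" "finite_dimensional_vector_space s2 B2"
    using M1.finite_dimensional M2.finite_dimensional by (elim exE)
  from B interpret fd1: finite_dimensional_vector_space s1 B1
    + fd2: finite_dimensional_vector_space s2 B2 .
  interpret P: finite_dimensional_vector_space_prod s1 s2 B1 B2 ..
  define r where "r = free_product s1 r1 s2 r2"
  have fp: "is_free_product s1 r1 s2 r2 r"
    unfolding r_def using M1 M2 by (rule free_product_is_free_product)
  then interpret R: q_matroid P.scale r by (simp add: is_free_product_def)
  have indep: "indep_space P.scale r I \<longleftrightarrow>
      r1 (slice1 I) = int (M1.dim (slice1 I)) \<and>
      int (M2.dim (snd ` I)) - r2 (snd ` I) \<le> r1 UNIV - r1 (slice1 I)"
    if "P.p.subspace I" for I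
    using fp that P.subspace_slice1[OF that]
    by (auto simp: is_free_product_def free_product_indep_def indep_space_def corank_def
        nullity_def fst_image_Int_range)
  note sA = P.subspace_slice1[OF A] and qA = P.subspace_snd_image[OF A]
  have "r A \<le> min (r1 (slice1 A) + int (M2.dim (snd ` A))) (r1 UNIV + r2 (snd ` A))"
  proof -
    obtain I where I: "I \<subseteq> A" "indep_space P.scale r I" "int (P.p.dim I) = r A"
      using R.indep_space_attains_rank[OF A] by blast
    have sI: "P.p.subspace I" using I(2) by (simp add: indep_space_def)
    have "r1 (slice1 I) \<le> r1 (slice1 A)"
      using I(1) by (intro M1.rank_mono P.subspace_slice1 sI A) (auto simp: slice1_def)
    moreover have "M2.dim (snd ` I) \<le> M2.dim (snd ` A)"
      using I(1) by (intro fd2.dim_subset image_mono)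
    moreover have "r2 (snd ` I) \<le> r2 (snd ` A)"
      using I(1) by (intro M2.rank_mono P.subspace_snd_image sI A image_mono)
    ultimately show ?thesis
      using I(2,3) indep[OF sI] P.dim_slice1_snd[OF sI] by linarith
  qed
  \<comment> \<open>For the converse, lift a subspace \<open>K\<close> of \<open>\<pi>2 A\<close> of full rank, whose nullity is as large as
    the bound by the corank of \<open>A \<inter> E1\<close> allows, and add a maximal independent \<open>J\<close> in \<open>A \<inter> E1\<close>.\<close>
  moreover have "min (r1 (slice1 A) + int (M2.dim (snd ` A))) (r1 UNIV + r2 (snd ` A)) \<le> r A"
  proof -
    obtain J where J: "J \<subseteq> slice1 A" "indep_space s1 r1 J" "int (M1.dim J) = r1 (slice1 A)"
      using M1.indep_space_attains_rank[OF sA] by blast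
    obtain K0 where K0: "K0 \<subseteq> snd ` A" "indep_space s2 r2 K0" "int (M2.dim K0) = r2 (snd ` A)"
      using M2.indep_space_attains_rank[OF qA] by blast
    have sJ: "M1.subspace J" and sK0: "M2.subspace K0"
      using J K0 by (auto simp: indep_space_def)
    \<comment> \<open>Chosen so that \<open>r1 (slice1 A) + n\<close> is exactly the claimed
      minimum. The argument of \<open>nat\<close> is nonnegative, being at least
      \<open>dim K0\<close>.\<close>
    define n where "n = nat (min (int (M2.dim (snd ` A))) (r2 (snd ` A) + r1 UNIV - r1 (slice1 A)))"
    have "r1 (slice1 A) \<le> r1 UNIV" by (intro M1.rank_mono sA) simp_all
    moreover have "r2 (snd ` A) \<le> int (M2.dim (snd ` A))" by (rule M2.rank_le_dim[OF qA])
    ultimately have n: "M2.dim K0 \<le> n" "n \<le> M2.dim (snd ` A)"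
      "int n = min (int (M2.dim (snd ` A))) (r2 (snd ` A) + r1 UNIV - r1 (slice1 A))"
      unfolding n_def using K0(3) by linarith+
    obtain K where K: "M2.subspace K" "K0 \<subseteq> K" "K \<subseteq> snd ` A" "M2.dim K = n"
      using fd2.intermediate_subspace[OF sK0 qA K0(1) n(1,2)] .
    \<comment> \<open>Containing \<open>K0\<close> gives \<open>K\<close> full rank in
      \<open>\<pi>2 A\<close>, which bounds its nullity by \<open>n - r2 (snd\<close> applied to
      \<open>A)\<close>.\<close>
    have "r2 K0 \<le> r2 K" using sK0 K(1,2) by (rule M2.rank_mono)
    then have r2K: "r2 (snd ` A) \<le> r2 K"
      using K0 by (simp add: indep_space_def)
    interpret SP: vector_space_pair P.scale s2 ..
    \<comment> \<open>\<open>g\<close> is a linear section of \<open>snd\<close> over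
      \<open>\<pi>2 A\<close> with values in \<open>A\<close>. The lift of \<open>K\<close> along it
      meets \<open>E1\<close> only in zero, so adding \<open>J\<close> gives slice \<open>J\<close>
      and projection \<open>K\<close>.\<close>
    obtain g where g: "range g \<subseteq> A" "Vector_Spaces.linear s2 P.scale g" "\<forall>v\<in>snd ` A. snd (g v) = v"
      using SP.linear_exists_right_inverse_on[OF P.linear_snd A] by blast
    interpret g: Vector_Spaces.linear s2 P.scale g by (rule g(2))
    define I where "I = {u + v | u v. u \<in> J \<times> {0} \<and> v \<in> g ` K}"
    have sI: "P.p.subspace I"
      unfolding I_def
      by (intro P.p.subspace_sums P.subspace_Times sJ M2.subspace_single_0 g.subspace_image K(1))
    have "J \<times> {0} \<subseteq> A" "g ` K \<subseteq> A" using J(1) g(1) by (auto simp: slice1_def)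
    then have IA: "I \<subseteq> A"
      unfolding I_def using P.p.subspace_add[OF A] by blast
    have snd_g: "snd (g k) = k" if "k \<in> K" for k using that g(3) K(3) by blast
    have sndI: "snd ` I = K"
    proof
      show "snd ` I \<subseteq> K"
      proof
        fix y assume "y \<in> snd ` I"
        then obtain j k where "k \<in> K" "y = snd ((j, 0) + g k)" unfolding I_def by blast
        then show "y \<in> K" using snd_g by simp
      qed
      show "K \<subseteq> snd ` I"
      proof
        fix k assume k: "k \<in> K"
        then have "(0, 0) + g k \<in> I" unfolding I_def using M1.subspace_0[OF sJ] by blast
        then show "k \<in> snd ` I" using snd_g[OF k] by force
      qed
    qed
    have sliceI: "slice1 I = J"
    proof
      show "slice1 I \<subseteq> J"
      proof
        fix x assume "x \<in> slice1 I"
        then have "(x, 0) \<in> I" by (simp add: slice1_def)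
        then obtain j k where jk: "j \<in> J" "k \<in> K" "(x, 0) = (j, 0) + g k"
          unfolding I_def by blast
        then have "snd (g k) = 0" by (metis add_0 snd_add snd_conv)
        then have "k = 0" using snd_g[OF jk(2)] by simp
        then show "x \<in> J" using jk g.zero by (simp add: zero_prod_def)
      qed
      show "J \<subseteq> slice1 I"
      proof
        fix x assume "x \<in> J"
        then have "(x, 0) + g 0 \<in> I" unfolding I_def using M2.subspace_0[OF K(1)] by blast
        then show "x \<in> slice1 I" using g.zero by (simp add: slice1_def)
      qed
    qed
    have rJ: "r1 J = int (M1.dim J)" using J(2) by (simp add: indep_space_def)
    have "indep_space P.scale r I"
      unfolding indep[OF sI] sndI sliceI using rJ J(3) r2K n(3) K(4) by linarith
    then have "int (P.p.dim I) \<le> r A" by (rule R.indep_space_dim_le_rank[OF A IA])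
    then show ?thesis
      using P.dim_slice1_snd[OF sI] J(3) n(3) K(4) unfolding sndI sliceI by linarith
  qed
  ultimately show ?thesis unfolding r_def by linarith
qed

section \<open>Complements for the orthogonal sum of two forms\<close>

locale nondegenerate_form_pair =
  F1: nondegenerate_form s1 B1 b1 + F2: nondegenerate_form s2 B2 b2
  for s1 :: "'k::field \<Rightarrow> 'b::ab_group_add \<Rightarrow> 'b" and B1 b1
    and s2 :: "'k \<Rightarrow> 'c::ab_group_add \<Rightarrow> 'c" and B2 b2
begin

sublocale P: finite_dimensional_vector_space_prod s1 s2 B1 B2 ..

sublocale F: nondegenerate_form P.scale P.Basis_pair "form_sum b1 b2"
proof unfold_locales
  note l = F1.linear_right F1.linear_left F2.linear_right F2.linear_left
  note l = l[unfolded linear_iff_module_hom]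
  show "form_sum b1 b2 x (y + z) = form_sum b1 b2 x y + form_sum b1 b2 x z" for x y z
    using l[THEN module_hom.add] by (simp add: form_sum_def)
  show "form_sum b1 b2 x (P.scale c y) = c * form_sum b1 b2 x y" for x y c
    using l[THEN module_hom.scale] by (simp add: form_sum_def P.scale_def distrib_left)
  show "form_sum b1 b2 (x + z) y = form_sum b1 b2 x y + form_sum b1 b2 z y" for x y z
    using l[THEN module_hom.add] by (simp add: form_sum_def)
  show "form_sum b1 b2 (P.scale c x) y = c * form_sum b1 b2 x y" for x y c
    using l[THEN module_hom.scale] by (simp add: form_sum_def P.scale_def distrib_left)
  fix y assume y: "\<And>x. form_sum b1 b2 x y = 0"
  have z: "b1 0 u = 0" "b2 0 v = 0" for u v
    using l(2,4)[THEN module_hom.zero] by auto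
  have "b1 x (fst y) = 0" for x using y[of "(x, 0)"] z by (simp add: form_sum_def)
  then have "fst y = 0" by (rule F1.nondegenerate)
  moreover have "b2 x (snd y) = 0" for x using y[of "(0, x)"] z by (simp add: form_sum_def)
  then have "snd y = 0" by (rule F2.nondegenerate)
  ultimately show "y = 0" by (simp add: prod_eq_iff)
qed (simp_all add: algebra_simps)

lemma form_zero: "b1 0 u = 0" "b1 u 0 = 0" "b2 0 v = 0" "b2 v 0 = 0"
  using module_hom.zero[OF F1.linear_left[unfolded linear_iff_module_hom]]
    module_hom.zero[OF F1.linear_right[unfolded linear_iff_module_hom]]
    module_hom.zero[OF F2.linear_left[unfolded linear_iff_module_hom]]
    module_hom.zero[OF F2.linear_right[unfolded linear_iff_module_hom]]
  by blast+

text \<open>Pairing with \<open>(x, 0)\<close> sees only first coordinates.\<close>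

lemma slice1_orth: "slice1 (orth (form_sum b1 b2) A) = orth b1 (fst ` A)"
  by (simp add: slice1_def orth_def form_sum_def form_zero)

text \<open>Testing against the vectors \<open>(0, y)\<close> of \<open>A\<close> gives one
  inclusion. The dimensions agree by \<open>dim_orth\<close> for all three forms,
  \<open>slice1_orth\<close>, and rank-nullity for both projections.\<close>

lemma snd_orth:
  assumes A: "P.p.subspace A"
  shows "snd ` orth (form_sum b1 b2) A = orth b2 (slice2 A)"
proof (rule F2.subspace_dim_equal)
  show "F2.subspace (snd ` orth (form_sum b1 b2) A)"
    by (intro P.subspace_snd_image F.subspace_orth)
  show "F2.subspace (orth b2 (slice2 A))" by (rule F2.subspace_orth)
  show "snd ` orth (form_sum b1 b2) A \<subseteq> orth b2 (slice2 A)"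
  proof
    fix v assume "v \<in> snd ` orth (form_sum b1 b2) A"
    then obtain u where "\<forall>x\<in>A. b1 (fst x) u + b2 (snd x) v = 0"
      by (auto simp: orth_def form_sum_def)
    then show "v \<in> orth b2 (slice2 A)"
      using form_zero(1) by (fastforce simp: slice2_def orth_def)
  qed
  have "P.p.dim (UNIV :: ('b \<times> 'c) set) = F1.dim (UNIV :: 'b set) + F2.dim (UNIV :: 'c set)"
    using P.dim_Times[OF F1.subspace_UNIV F2.subspace_UNIV] by simp
  then show "F2.dim (orth b2 (slice2 A)) \<le> F2.dim (snd ` orth (form_sum b1 b2) A)"
    using F.dim_orth[OF A] P.dim_slice1_snd[OF F.subspace_orth, of A] P.dim_slice2_fst[OF A]
      F1.dim_orth[OF P.subspace_fst_image[OF A]] F2.dim_orth[OF P.subspace_slice2[OF A]]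
    unfolding slice1_orth by linarith
qed

end

section \<open>Duality of the free product\<close>

theorem proposition4p5:
  fixes s1 :: "'k::{finite,field} \<Rightarrow> 'b::ab_group_add \<Rightarrow> 'b"
    and s2 :: "'k \<Rightarrow> 'c::ab_group_add \<Rightarrow> 'c"
    and r1 :: "'b set \<Rightarrow> int" and r2 :: "'c set \<Rightarrow> int"
    and b1 :: "'b \<Rightarrow> 'b \<Rightarrow> 'k" and b2 :: "'c \<Rightarrow> 'c \<Rightarrow> 'k"
  assumes "q_matroid s1 r1" and "q_matroid s2 r2"
    and "duality_form s1 b1" and "duality_form s2 b2"
  shows "q_matroid_iso
           (module_prod.scale s1 s2)
           (dual_rank (module_prod.scale s1 s2) (form_sum b1 b2) (free_product s1 r1 s2 r2))
           (module_prod.scale s2 s1)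
           (free_product s2 (dual_rank s2 b2 r2) s1 (dual_rank s1 b1 r1))"
proof -
  interpret M1: q_matroid s1 r1 by fact
  interpret M2: q_matroid s2 r2 by fact
  obtain B1 B2 where B: "finite_dimensional_vector_space s1 B1" "finite_dimensional_vector_space s2 B2"
    using M1.finite_dimensional M2.finite_dimensional by (elim exE)
  note F = duality_form_nondegenerate[OF B(1) assms(3)] duality_form_nondegenerate[OF B(2) assms(4)]
  interpret D: nondegenerate_form_pair s1 B1 b1 s2 B2 b2
    using F by (simp add: nondegenerate_form_pair_def)
  note M1' = q_matroid_dual_rank[OF assms(1) F(1)] and M2' = q_matroid_dual_rank[OF assms(2) F(2)]
  let ?b = "form_sum b1 b2"
  have univ: "free_product s1 r1 s2 r2 UNIV = r1 UNIV + r2 UNIV"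
    using M2.rank_le_dim[OF M2.subspace_UNIV]
    by (simp add: free_product_rank[OF assms(1,2) D.P.p.subspace_UNIV] slice1_def del: D.F2.dim_UNIV)
  \<comment> \<open>The complement of the whole space is \<open>{0}\<close>, where the rank is
    squeezed to 0.\<close>
  have dual_univ: "dual_rank s2 b2 r2 UNIV = int (M2.dim (UNIV :: 'c set)) - r2 UNIV"
    using M2.rank_nonneg[OF M2.subspace_single_0] M2.rank_le_dim[OF M2.subspace_single_0]
    by (simp add: dual_rank_def D.F2.orth_UNIV del: D.F2.dim_UNIV)
  \<comment> \<open>\<open>dual_univ\<close> is rewritten while the duals of the factors are still
    folded. Then \<open>dim V = dim (slice2 V) + dim (\<pi>1 V)\<close> matches the first term of
    each minimum with the second of the other.\<close>
  have "free_product s2 (dual_rank s2 b2 r2) s1 (dual_rank s1 b1 r1) (prod.swap ` V)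
      = dual_rank D.P.scale ?b (free_product s1 r1 s2 r2) V"
    if V: "D.P.p.subspace V" for V
    using D.P.dim_slice2_fst[OF V] D.F2.dim_orth[OF D.P.subspace_slice2[OF V]]
    unfolding free_product_rank[OF M2' M1' D.P.subspace_swap_image[OF V]] dual_univ
      dual_rank_def[of D.P.scale] univ
      free_product_rank[OF assms(1,2) D.F.subspace_orth] D.slice1_orth D.snd_orth[OF V]
      slice1_swap snd_swap
    unfolding dual_rank_def by linarith
  then show ?thesis
    unfolding q_matroid_iso_def using D.P.linear_swap bij_swap by blast
qed

end
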